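(* Let $r$ be a positive number. For any graph $G$ with no isolated edges, $$\chi_{r-vsdt}(G)\le \chi'_{s}(G,r)+\chi(G).$$
   Context: All graphs are finite, simple and undirected. For a vertex $u$ of $G$, let $N\langle u\rangle = N[u]\cup\{uv : v\in N(u)\}$, where $N(u)$ and $N[u]=N(u)\cup\{u\}$ are the open and closed neighborhoods; so $N\langle u\rangle$ consists of $u$, its neighbors and its incident edges. A proper $\kappa$-total coloring of $G$ is a map $f:V(G)\cup E(G)\to\{1,\dots,\kappa\}$ such that any two adjacent vertices, any two edges sharing an endpoint, and any vertex and incident edge receive different colors. Put $C_f\langle u\rangle=\{f(x): x\in N\langle u\rangle\}$. For a graph $G$ with no isolated edges (no connected component is $K_2$) and a positive number $r$, a $\kappa$-$r$-vertex-strongly-distinguishing total coloring ($\kappa$-$D(r)$-VSDTC) of $G$ is a proper $\kappa$-total coloring $f$ such that $C_f\langle u\rangle\neq C_f\langle v\rangle$ for any two distinct vertices $u,v$ at distance at most $r$ (vertices in different components are at infinite distance). $\chi_{r-vsdt}(G)$ is the minimum $\kappa$ for which $G$ admits a $\kappa$-$D(r)$-VSDTC. An $r$-strong edge coloring of $G$ with $\kappa$ colors is a proper edge coloring $g:E(G)\to\{1,\dots,\kappa\}$ such that $C_g(u)\ne C_g(v)$ for any two distinct vertices $u,v$ at distance at most $r$, where $C_g(u)=\{g(uw): uw\in E(G)\}$. The $r$-strong edge chromatic number $\chi'_s(G,r)$ is the minimum number of colors in such a coloring. $\chi(G)$ is the usual (vertex) chromatic number. *)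

theory Defs
  imports Complex_Main "HOL-Library.Extended_Real"
begin

text \<open>A finite simple undirected graph is given by its vertex set \<open>V\<close> and its set \<open>E\<close> of edges, an edge
  being a two-element set of vertices.\<close>

definition simple_graph :: "'a set \<Rightarrow> 'a set set \<Rightarrow> bool" where
  "simple_graph V E \<longleftrightarrow> finite V \<and> (\<forall>e\<in>E. e \<subseteq> V \<and> card e = 2)"

definition adj_rel :: "'a set set \<Rightarrow> ('a \<times> 'a) set" where
  "adj_rel E = {(u, v). {u, v} \<in> E}"

definition nbhd :: "'a set set \<Rightarrow> 'a \<Rightarrow> 'a set" where
  "nbhd E u = {v. {u, v} \<in> E}"

text \<open>The distance is the length of a shortest walk. The infimum of the empty set is \<open>\<infinity>\<close>, so vertices in
  different components are at infinite distance.\<close>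

definition gdist :: "'a set set \<Rightarrow> 'a \<Rightarrow> 'a \<Rightarrow> enat" where
  "gdist E u v = (INF n\<in>{n. (u, v) \<in> adj_rel E ^^ n}. enat n)"

definition within_dist :: "real \<Rightarrow> 'a set set \<Rightarrow> 'a \<Rightarrow> 'a \<Rightarrow> bool" where
  "within_dist r E u v \<longleftrightarrow> ereal_of_enat (gdist E u v) \<le> ereal r"

definition comp_verts :: "'a set \<Rightarrow> 'a set set \<Rightarrow> 'a \<Rightarrow> 'a set" where
  "comp_verts V E u = {v \<in> V. (u, v) \<in> (adj_rel E)\<^sup>*}"

definition induced_edges :: "'a set set \<Rightarrow> 'a set \<Rightarrow> 'a set set" where
  "induced_edges E W = {e \<in> E. e \<subseteq> W}"

definition is_K2 :: "'a set \<Rightarrow> 'a set set \<Rightarrow> bool" where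
  "is_K2 V E \<longleftrightarrow> (\<exists>x y. x \<noteq> y \<and> V = {x, y} \<and> E = {{x, y}})"

definition no_isolated_edges :: "'a set \<Rightarrow> 'a set set \<Rightarrow> bool" where
  "no_isolated_edges V E \<longleftrightarrow>
     (\<forall>u\<in>V. \<not> is_K2 (comp_verts V E u) (induced_edges E (comp_verts V E u)))"


text \<open>The disjoint union \<open>V(G) \<union> E(G)\<close> is the sum \<open>V <+> E\<close>, with vertices tagged by \<open>Inl\<close> and edges
  by \<open>Inr\<close>.\<close>

definition proper_total_coloring ::
    "'a set \<Rightarrow> 'a set set \<Rightarrow> nat \<Rightarrow> ('a + 'a set \<Rightarrow> nat) \<Rightarrow> bool" where
  "proper_total_coloring V E \<kappa> f \<longleftrightarrow>
     f ` (V <+> E) \<subseteq> {1..\<kappa>} \<and>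
     (\<forall>u\<in>V. \<forall>v\<in>V. {u, v} \<in> E \<longrightarrow> f (Inl u) \<noteq> f (Inl v)) \<and>
     (\<forall>e\<in>E. \<forall>e'\<in>E. e \<noteq> e' \<and> e \<inter> e' \<noteq> {} \<longrightarrow> f (Inr e) \<noteq> f (Inr e')) \<and>
     (\<forall>u\<in>V. \<forall>e\<in>E. u \<in> e \<longrightarrow> f (Inl u) \<noteq> f (Inr e))"

definition total_nbhd :: "'a set set \<Rightarrow> 'a \<Rightarrow> ('a + 'a set) set" where
  "total_nbhd E u = Inl ` insert u (nbhd E u) \<union> Inr ` {{u, v} | v. v \<in> nbhd E u}"

definition vsdtc ::
    "'a set \<Rightarrow> 'a set set \<Rightarrow> real \<Rightarrow> nat \<Rightarrow> ('a + 'a set \<Rightarrow> nat) \<Rightarrow> bool" where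
  "vsdtc V E r \<kappa> f \<longleftrightarrow> proper_total_coloring V E \<kappa> f \<and>
     (\<forall>u\<in>V. \<forall>v\<in>V. u \<noteq> v \<and> within_dist r E u v \<longrightarrow> f ` total_nbhd E u \<noteq> f ` total_nbhd E v)"

definition chi_vsdt :: "'a set \<Rightarrow> 'a set set \<Rightarrow> real \<Rightarrow> nat" where
  "chi_vsdt V E r = (LEAST \<kappa>. \<exists>f. vsdtc V E r \<kappa> f)"


definition proper_edge_coloring :: "'a set set \<Rightarrow> nat \<Rightarrow> ('a set \<Rightarrow> nat) \<Rightarrow> bool" where
  "proper_edge_coloring E \<kappa> g \<longleftrightarrow> g ` E \<subseteq> {1..\<kappa>} \<and>
     (\<forall>e\<in>E. \<forall>e'\<in>E. e \<noteq> e' \<and> e \<inter> e' \<noteq> {} \<longrightarrow> g e \<noteq> g e')"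

definition strong_edge_coloring ::
    "'a set \<Rightarrow> 'a set set \<Rightarrow> real \<Rightarrow> nat \<Rightarrow> ('a set \<Rightarrow> nat) \<Rightarrow> bool" where
  "strong_edge_coloring V E r \<kappa> g \<longleftrightarrow> proper_edge_coloring E \<kappa> g \<and>
     (\<forall>u\<in>V. \<forall>v\<in>V. u \<noteq> v \<and> within_dist r E u v \<longrightarrow>
        {g {u, w} | w. {u, w} \<in> E} \<noteq> {g {v, w} | w. {v, w} \<in> E})"

definition chi_strong :: "'a set \<Rightarrow> 'a set set \<Rightarrow> real \<Rightarrow> nat" where
  "chi_strong V E r = (LEAST \<kappa>. \<exists>g. strong_edge_coloring V E r \<kappa> g)"


definition proper_vertex_coloring :: "'a set \<Rightarrow> 'a set set \<Rightarrow> nat \<Rightarrow> ('a \<Rightarrow> nat) \<Rightarrow> bool" where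
  "proper_vertex_coloring V E \<kappa> c \<longleftrightarrow> c ` V \<subseteq> {1..\<kappa>} \<and>
     (\<forall>u\<in>V. \<forall>v\<in>V. {u, v} \<in> E \<longrightarrow> c u \<noteq> c v)"

definition chi :: "'a set \<Rightarrow> 'a set set \<Rightarrow> nat" where
  "chi V E = (LEAST \<kappa>. \<exists>c. proper_vertex_coloring V E \<kappa> c)"


text \<open>The colorings in question exist, so that the three \<open>LEAST\<close>s above are genuine minima.\<close>

lemma within_dist_connected:
  assumes "within_dist r E u v"
  shows "(u, v) \<in> (adj_rel E)\<^sup>*"
proof (rule ccontr)
  assume "(u, v) \<notin> (adj_rel E)\<^sup>*"
  then have "{n. (u, v) \<in> adj_rel E ^^ n} = {}"
    by (auto dest: relpow_imp_rtrancl)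
  then have "gdist E u v = \<infinity>"
    by (simp only: gdist_def) (simp add: top_enat_def)
  with assms show False by (simp add: within_dist_def)
qed

lemma incident_edges_distinct:
  assumes G: "simple_graph V E" and K: "no_isolated_edges V E"
    and u: "u \<in> V" and "v \<in> V" and uv: "u \<noteq> v" and d: "within_dist r E u v"
  shows "{{u, w} | w. {u, w} \<in> E} \<noteq> {{v, w} | w. {v, w} \<in> E}"
proof
  assume eq: "{{u, w} | w. {u, w} \<in> E} = {{v, w} | w. {v, w} \<in> E}"
  have conn: "(u, v) \<in> (adj_rel E)\<^sup>*" using d by (rule within_dist_connected)
  then obtain w where w: "{u, w} \<in> E"
    using uv by (auto simp: adj_rel_def elim: converse_rtranclE)
  have only_v: "w = v" if "{u, w} \<in> E" for w
  proof -
    from that eq have "{u, w} \<in> {{v, w} | w. {v, w} \<in> E}" by blast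
    then show ?thesis using uv by (auto simp: doubleton_eq_iff)
  qed
  have only_u: "w = u" if "{v, w} \<in> E" for w
  proof -
    from that eq have "{v, w} \<in> {{u, w} | w. {u, w} \<in> E}" by blast
    then show ?thesis using uv by (auto simp: doubleton_eq_iff)
  qed
  have uvE: "{u, v} \<in> E" using w only_v by blast
  have "x \<in> {u, v}" if "(u, x) \<in> (adj_rel E)\<^sup>*" for x
    using that by induction (use only_u only_v in \<open>auto simp: adj_rel_def\<close>)
  then have C: "comp_verts V E u = {u, v}"
    using conn u \<open>v \<in> V\<close> by (auto simp: comp_verts_def)
  have "e = {u, v}" if "e \<in> E" "e \<subseteq> {u, v}" for e
  proof -
    have "card e = 2" using G that by (simp add: simple_graph_def)
    with that(2) uv show ?thesis by (intro card_subset_eq) auto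
  qed
  then have "induced_edges E {u, v} = {{u, v}}"
    using uvE by (auto simp: induced_edges_def)
  then have "is_K2 (comp_verts V E u) (induced_edges E (comp_verts V E u))"
    unfolding is_K2_def C using uv by blast
  with K u show False by (auto simp: no_isolated_edges_def)
qed

lemma simple_graph_finite_edges:
  assumes "simple_graph V E"
  shows "finite E"
  by (rule finite_subset[of _ "Pow V"]) (use assms in \<open>auto simp: simple_graph_def\<close>)

lemma ex_injective_coloring:
  assumes "finite A"
  obtains f :: "'b \<Rightarrow> nat" where "inj_on f A" "f ` A \<subseteq> {1..card A}"
proof -
  obtain h where h: "bij_betw h A {0..<card A}"
    using ex_bij_betw_finite_nat[OF assms] by blast
  show ?thesis
    by (rule that[of "\<lambda>x. Suc (h x)"])
       (use h in \<open>auto simp: bij_betw_def inj_on_def Suc_le_eq\<close>)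
qed

lemma ex_proper_vertex_coloring:
  assumes G: "simple_graph V E"
  shows "\<exists>\<kappa> c. proper_vertex_coloring V E \<kappa> c"
proof -
  obtain c :: "'a \<Rightarrow> nat" where c: "inj_on c V" "c ` V \<subseteq> {1..card V}"
    using ex_injective_coloring[of V] G by (auto simp: simple_graph_def)
  have "u \<noteq> v" if "{u, v} \<in> E" for u v
    using G that by (force simp: simple_graph_def)
  then have "proper_vertex_coloring V E (card V) c"
    using c by (auto simp: proper_vertex_coloring_def inj_on_def)
  then show ?thesis by blast
qed

lemma ex_strong_edge_coloring:
  assumes G: "simple_graph V E" and K: "no_isolated_edges V E"
  shows "\<exists>\<kappa> g. strong_edge_coloring V E r \<kappa> g"
proof -
  obtain g :: "'a set \<Rightarrow> nat" where g: "inj_on g E" "g ` E \<subseteq> {1..card E}"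
    using ex_injective_coloring[OF simple_graph_finite_edges[OF G]] by blast
  have im: "{g {u, w} | w. {u, w} \<in> E} = g ` {{u, w} | w. {u, w} \<in> E}" for u
    by blast
  have "{g {u, w} | w. {u, w} \<in> E} \<noteq> {g {v, w} | w. {v, w} \<in> E}"
    if "u \<in> V" "v \<in> V" "u \<noteq> v" "within_dist r E u v" for u v
    using incident_edges_distinct[OF G K that] unfolding im
    by (subst inj_on_image_eq_iff[OF g(1)]) auto
  then have "strong_edge_coloring V E r (card E) g"
    using g by (auto simp: strong_edge_coloring_def proper_edge_coloring_def inj_on_def)
  then show ?thesis by blast
qed

lemma ex_vsdtc:
  assumes G: "simple_graph V E" and K: "no_isolated_edges V E"
  shows "\<exists>\<kappa> f. vsdtc V E r \<kappa> f"
proof -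
  have "finite (V <+> E)"
    using G simple_graph_finite_edges[OF G] by (simp add: simple_graph_def)
  then obtain f :: "'a + 'a set \<Rightarrow> nat"
    where f: "inj_on f (V <+> E)" "f ` (V <+> E) \<subseteq> {1..card (V <+> E)}"
    using ex_injective_coloring by blast
  have ne: "u \<noteq> v" if "{u, v} \<in> E" for u v
    using G that by (force simp: simple_graph_def)
  have sub: "total_nbhd E u \<subseteq> V <+> E" if "u \<in> V" for u
    using G that by (auto simp: total_nbhd_def nbhd_def simple_graph_def)
  have edges: "{{u, w} | w. {u, w} \<in> E} = {e. Inr e \<in> total_nbhd E u}" for u
    by (auto simp: total_nbhd_def nbhd_def)
  have "f ` total_nbhd E u \<noteq> f ` total_nbhd E v"
    if "u \<in> V" "v \<in> V" "u \<noteq> v" "within_dist r E u v" for u v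
  proof
    assume "f ` total_nbhd E u = f ` total_nbhd E v"
    then have "total_nbhd E u = total_nbhd E v"
      using inj_on_image_eq_iff[OF f(1)] sub that by blast
    with incident_edges_distinct[OF G K that] show False by (simp add: edges)
  qed
  moreover have "proper_total_coloring V E (card (V <+> E)) f"
    unfolding proper_total_coloring_def
    using f(2) ne by (auto dest!: inj_onD[OF f(1)])
  ultimately have "vsdtc V E r (card (V <+> E)) f"
    by (auto simp: vsdtc_def)
  then show ?thesis by blast
qed

end

theory Submission
  imports Defs
begin

text \<open>Color the edges by an optimal \<open>r\<close>-strong edge coloring and the vertices by an optimal proper
  vertex coloring, using disjoint palettes. The colors of the edge palette that occur in
  \<open>C\<^sub>f\<langle>u\<rangle>\<close> are exactly those of the edges at \<open>u\<close>, so \<open>C\<^sub>f\<langle>u\<rangle>\<close> determines the edge color set of \<open>u\<close>.\<close>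

definition join_coloring ::
    "nat \<Rightarrow> ('a set \<Rightarrow> nat) \<Rightarrow> ('a \<Rightarrow> nat) \<Rightarrow> 'a + 'a set \<Rightarrow> nat" where
  "join_coloring s g c = case_sum (\<lambda>u. s + c u) g"

lemma join_coloring_simps [simp]:
  "join_coloring s g c (Inl u) = s + c u"
  "join_coloring s g c (Inr e) = g e"
  by (simp_all add: join_coloring_def)

text \<open>Shifting by \<open>s\<close> is injective, so conflicts between two vertices or between
  two edges are already excluded by \<open>c\<close> and \<open>g\<close>. Only a vertex meeting an
  incident edge is a new case.\<close>

lemma proper_total_coloring_join:
  assumes "proper_edge_coloring E s g" and "proper_vertex_coloring V E k c"
  shows "proper_total_coloring V E (s + k) (join_coloring s g c)"
proof -
  have g: "1 \<le> g e" "g e \<le> s" if "e \<in> E" for e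
    using assms(1) that by (auto simp: proper_edge_coloring_def)
  have c: "1 \<le> c u" "c u \<le> k" if "u \<in> V" for u
    using assms(2) that by (auto simp: proper_vertex_coloring_def)
  have "join_coloring s g c x \<in> {1..s + k}" if "x \<in> V <+> E" for x
    using that
  proof (rule PlusE)
    fix u assume "u \<in> V" "x = Inl u"
    then show ?thesis using c[of u] by simp
  next
    fix e assume "e \<in> E" "x = Inr e"
    then show ?thesis using g[of e] by simp
  qed
  then have "join_coloring s g c ` (V <+> E) \<subseteq> {1..s + k}"
    by blast
  \<comment> \<open>Incidence is irrelevant here: edge colors are at most \<open>s\<close>, vertex
    colors at least \<open>s + 1\<close>.\<close>
  moreover have "s + c u \<noteq> g e" if "u \<in> V" "e \<in> E" for u e
    using c(1)[OF that(1)] g(2)[OF that(2)] by linarith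
  ultimately show ?thesis
    using assms
    by (simp add: proper_total_coloring_def proper_edge_coloring_def proper_vertex_coloring_def)
qed

text \<open>Cutting with \<open>{..s}\<close> removes the colors of \<open>u\<close> and its
  neighbors, which all exceed \<open>s\<close>, and keeps every edge color. Thus the edge color set
  can be recovered from the total one.\<close>

lemma join_coloring_total_nbhd_edge_palette:
  assumes G: "simple_graph V E" and g: "proper_edge_coloring E s g"
    and c: "proper_vertex_coloring V E k c" and u: "u \<in> V"
  shows "join_coloring s g c ` total_nbhd E u \<inter> {..s} = {g {u, w} | w. {u, w} \<in> E}"
proof -
  have "insert u (nbhd E u) \<subseteq> V"
    using G u by (auto simp: nbhd_def simple_graph_def)
  \<comment> \<open>Palettes start at 1, not 0; this makes \<open>s + c v\<close> strictly larger
    than \<open>s\<close>.\<close>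
  then have "c v \<ge> 1" if "v \<in> insert u (nbhd E u)" for v
    using c that by (force simp: proper_vertex_coloring_def)
  then have "(\<lambda>v. s + c v) ` insert u (nbhd E u) \<inter> {..s} = {}"
    by fastforce
  moreover have "join_coloring s g c ` total_nbhd E u
      = (\<lambda>v. s + c v) ` insert u (nbhd E u) \<union> {g {u, w} | w. {u, w} \<in> E}"
    by (auto simp: total_nbhd_def nbhd_def image_Un image_image)
  moreover have "{g {u, w} | w. {u, w} \<in> E} \<subseteq> {..s}"
    using g by (auto simp: proper_edge_coloring_def)
  ultimately show ?thesis by blast
qed

lemma vsdtc_join:
  assumes "simple_graph V E" and "strong_edge_coloring V E r s g"
    and "proper_vertex_coloring V E k c"
  shows "vsdtc V E r (s + k) (join_coloring s g c)"
proof -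
  have g: "proper_edge_coloring E s g"
    using assms(2) by (simp add: strong_edge_coloring_def)
  have "join_coloring s g c ` total_nbhd E u \<noteq> join_coloring s g c ` total_nbhd E v"
    if "u \<in> V" "v \<in> V" "u \<noteq> v" "within_dist r E u v" for u v
  proof
    assume eq: "join_coloring s g c ` total_nbhd E u = join_coloring s g c ` total_nbhd E v"
    note palette = join_coloring_total_nbhd_edge_palette[OF assms(1) g assms(3)]
    \<comment> \<open>Both sides are the traces on \<open>{..s}\<close> of the two total color sets,
      which \<open>eq\<close> identifies.\<close>
    have "{g {u, w} | w. {u, w} \<in> E} = {g {v, w} | w. {v, w} \<in> E}"
      unfolding palette[OF that(1), symmetric] palette[OF that(2), symmetric] eq ..
    moreover have "{g {u, w} | w. {u, w} \<in> E} \<noteq> {g {v, w} | w. {v, w} \<in> E}"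
      using assms(2) that unfolding strong_edge_coloring_def by simp
    ultimately show False by contradiction
  qed
  then show ?thesis
    using proper_total_coloring_join[OF g assms(3)] by (simp add: vsdtc_def)
qed

theorem theorem1p5:
  fixes V :: "'a set" and E :: "'a set set" and r :: real
  assumes "r > 0"
    and "simple_graph V E"
    and "no_isolated_edges V E"
  shows "chi_vsdt V E r \<le> chi_strong V E r + chi V E"
proof -
  \<comment> \<open>The minimum is attained because some strong edge coloring exists; this is where
    the absence of isolated edges enters.\<close>
  obtain g where g: "strong_edge_coloring V E r (chi_strong V E r) g"
    using LeastI_ex[OF ex_strong_edge_coloring[OF assms(2,3)]] unfolding chi_strong_def by blast
  obtain c where c: "proper_vertex_coloring V E (chi V E) c"
    using LeastI_ex[OF ex_proper_vertex_coloring[OF assms(2)]] unfolding chi_def by blast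
  show ?thesis
    unfolding chi_vsdt_def using vsdtc_join[OF assms(2) g c] by (blast intro: Least_le)
qed

end
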